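(* For any finite group $G$ and any field $k$, the adjoint cohomology groups of the Hopf algebra $k^G$ of functions on $G$ satisfy $H^n_{\mathrm{ad}}(k^G;k^G)=0$ for $n=1,2$.
   Context: $k^G$ is the algebra of functions $G\to k$ with pointwise operations, with Hopf algebra structure, via $k^{G\times G}\cong k^G\otimes k^G$, given by comultiplication $\Delta(f)(u,v)=f(uv)$ and antipode $S(f)(x)=f(x^{-1})$ (counit: evaluation at the identity of $G$). For a Hopf algebra $H$ over $k$ with multiplication $\mu$, comultiplication $\Delta$, antipode $S$, Sweedler notation $\Delta(y)=y_{(1)}\otimes y_{(2)}$ and flip $\tau(x\otimes y)=y\otimes x$, the adjoint map is $\mathrm{ad}(x\otimes y)=S(y_{(1)})\,x\,y_{(2)}$. Put $C^1_{\mathrm{ad}}(H;H)=\{f\in \mathrm{Hom}_k(H,H) : f\mu=\mu(f\otimes 1)+\mu(1\otimes f),\ \Delta f=(f\otimes 1)\Delta+(1\otimes f)\Delta\}$, $C^2_{\mathrm{ad}}(H;H)=\mathrm{Hom}(H^{\otimes 2},H)$, $C^3_{\mathrm{ad}}(H;H)=\mathrm{Hom}(H^{\otimes 3},H)\oplus\mathrm{Hom}(H^{\otimes 2},H^{\otimes 2})$ ($k$-linear maps). Differentials: $D_1:C^1_{\mathrm{ad}}\to C^2_{\mathrm{ad}}$, $D_1(f)=\mathrm{ad}(1\otimes f)-f\,\mathrm{ad}+\mathrm{ad}(f\otimes 1)$; $D_2:C^2_{\mathrm{ad}}\to C^3_{\mathrm{ad}}$, $D_2(\phi)=(d^{2,1}(\phi),d^{2,2}(\phi))$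 with $d^{2,1}(\phi)=\mathrm{ad}(\phi\otimes 1)+\phi(\mathrm{ad}\otimes 1)-\phi(1\otimes\mu)$, $d^{2,2}(\phi)=(\phi\otimes\mu)(1\otimes\tau\otimes 1)(\Delta\otimes\Delta)-(1\otimes\mu)(\tau\otimes 1)(1\otimes\Delta)(1\otimes\phi)(\tau\otimes 1)(1\otimes\Delta)$. With $C^0=0$ and $D_0=0$, one has $H^1_{\mathrm{ad}}(H;H)=\ker D_1$ and $H^2_{\mathrm{ad}}(H;H)=\ker D_2/\mathrm{Im}\,D_1$. *)

theory Defs
  imports
    Complex_Main
    "HOL-Library.Function_Algebras"
    "HOL-Library.Product_Plus"
    "HOL-Algebra.Elementary_Groups"
begin

section \<open>Function spaces and their tensor products\<close>

text \<open>
  For a finite type \<open>'a\<close> and a field \<open>'k\<close> the vector space of functions on \<open>'a\<close> is the type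
  \<open>'a \<Rightarrow> 'k\<close> with the pointwise operations of \<open>Function_Algebras\<close>.
  Throughout, the tensor product of \<open>'a \<Rightarrow> 'k\<close> and \<open>'b \<Rightarrow> 'k\<close> is realised as \<open>'a \<times> 'b \<Rightarrow> 'k\<close>
  via \<open>(u \<otimes> v) (a, b) = u a * v b\<close>; \<open>tensor_universal\<close> below is its universal property.
  The ground field itself, as the empty tensor power, is \<open>unit \<Rightarrow> 'k\<close>.
\<close>

definition fscale :: "'k::field \<Rightarrow> ('a \<Rightarrow> 'k) \<Rightarrow> 'a \<Rightarrow> 'k"
  where "fscale c f = (\<lambda>x. c * f x)"

abbreviation klinear :: "(('a \<Rightarrow> 'k::field) \<Rightarrow> ('b \<Rightarrow> 'k)) \<Rightarrow> bool"
  where "klinear \<equiv> Vector_Spaces.linear fscale fscale"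

definition pure_tensor :: "('a \<Rightarrow> 'k::field) \<Rightarrow> ('b \<Rightarrow> 'k) \<Rightarrow> ('a \<times> 'b \<Rightarrow> 'k)"
  where "pure_tensor u v = (\<lambda>(a, b). u a * v b)"

definition delta :: "'a \<Rightarrow> 'a \<Rightarrow> 'k::field"
  where "delta a = (\<lambda>x. if x = a then 1 else 0)"

text \<open>
  The tensor product of two linear maps, given by its values on the basis
  \<open>delta a \<otimes> delta b\<close>; see \<open>tensor_map_pure\<close> and \<open>tensor_map_linear\<close>.
\<close>

definition tensor_map ::
    "(('a::finite \<Rightarrow> 'k::field) \<Rightarrow> ('c \<Rightarrow> 'k)) \<Rightarrow> (('b::finite \<Rightarrow> 'k) \<Rightarrow> ('d \<Rightarrow> 'k))
      \<Rightarrow> ('a \<times> 'b \<Rightarrow> 'k) \<Rightarrow> ('c \<times> 'd \<Rightarrow> 'k)"  (infixr "\<boxtimes>" 75)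
  where "f \<boxtimes> g = (\<lambda>F (c, d). \<Sum>a\<in>UNIV. \<Sum>b\<in>UNIV. F (a, b) * f (delta a) c * g (delta b) d)"

definition flip :: "('a \<times> 'b \<Rightarrow> 'k) \<Rightarrow> ('b \<times> 'a \<Rightarrow> 'k)"
  where "flip F = (\<lambda>(b, a). F (a, b))"

definition assocl :: "('a \<times> ('b \<times> 'c) \<Rightarrow> 'k) \<Rightarrow> (('a \<times> 'b) \<times> 'c \<Rightarrow> 'k)"
  where "assocl F = (\<lambda>((a, b), c). F (a, (b, c)))"

definition assocr :: "(('a \<times> 'b) \<times> 'c \<Rightarrow> 'k) \<Rightarrow> ('a \<times> ('b \<times> 'c) \<Rightarrow> 'k)"
  where "assocr F = (\<lambda>(a, (b, c)). F ((a, b), c))"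

definition unitl :: "(unit \<times> 'a \<Rightarrow> 'k) \<Rightarrow> ('a \<Rightarrow> 'k)"
  where "unitl F = (\<lambda>a. F ((), a))"

definition unitr :: "('a \<times> unit \<Rightarrow> 'k) \<Rightarrow> ('a \<Rightarrow> 'k)"
  where "unitr F = (\<lambda>a. F (a, ()))"

text \<open>
  Tensor powers are nested to the right: the third power of \<open>'x \<Rightarrow> 'k\<close> is \<open>'x \<times> ('x \<times> 'x) \<Rightarrow> 'k\<close>.
  The map \<open>swap12\<close> is \<open>\<tau> \<otimes> 1\<close> on a triple tensor product in this bracketing, and
  \<open>interchange\<close> is \<open>1 \<otimes> \<tau> \<otimes> 1\<close> on a fourfold one bracketed as two pairs.
\<close>

definition swap12 ::
    "('a::finite \<times> ('b::finite \<times> 'c::finite) \<Rightarrow> 'k::field) \<Rightarrow> ('b \<times> ('a \<times> 'c) \<Rightarrow> 'k)"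
  where "swap12 = assocr \<circ> (flip \<boxtimes> id) \<circ> assocl"

definition interchange ::
    "(('a::finite \<times> 'b::finite) \<times> ('c::finite \<times> 'd::finite) \<Rightarrow> 'k::field)
      \<Rightarrow> (('a \<times> 'c) \<times> ('b \<times> 'd) \<Rightarrow> 'k)"
  where "interchange = assocl \<circ> (id \<boxtimes> swap12) \<circ> assocr"

lemma vector_space_fscale: "vector_space (fscale :: 'k::field \<Rightarrow> ('a \<Rightarrow> 'k) \<Rightarrow> _)"
  by unfold_locales (auto simp: fscale_def fun_eq_iff algebra_simps)

lemma klinear_iff:
  "klinear f \<longleftrightarrow> (\<forall>u v. f (u + v) = f u + f v) \<and> (\<forall>c u. f (fscale c u) = fscale c (f u))"
  by (simp add: Vector_Spaces.linear_iff vector_space_fscale)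

lemma sum_fun_apply: "(\<Sum>i\<in>I. f i) x = (\<Sum>i\<in>I. f i x :: 'k::field)"
  by (induction I rule: infinite_finite_induct) auto

lemma sum_mult_delta:
  "(\<Sum>a\<in>UNIV. h a * delta a (x :: 'a::finite)) = (h x :: 'k::field)"
proof -
  have "(\<Sum>a\<in>UNIV. h a * delta a x) = (\<Sum>a\<in>UNIV. if x = a then h a else 0)"
    by (rule sum.cong) (auto simp: delta_def)
  then show ?thesis by simp
qed

lemma delta_expansion:
  fixes u :: "'a::finite \<Rightarrow> 'k::field"
  shows "u = (\<Sum>a\<in>UNIV. fscale (u a) (delta a))"
  by (rule ext) (simp add: sum_fun_apply fscale_def sum_mult_delta)

lemma linear_expansion:
  fixes u :: "'a::finite \<Rightarrow> 'k::field"
  assumes "Vector_Spaces.linear fscale s f"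
  shows "f u = (\<Sum>a\<in>UNIV. s (u a) (f (delta a)))"
proof -
  interpret Vector_Spaces.linear fscale s f by (fact assms)
  have "f u = f (\<Sum>a\<in>UNIV. fscale (u a) (delta a))"
    using delta_expansion[of u] by simp
  also have "\<dots> = (\<Sum>a\<in>UNIV. s (u a) (f (delta a)))"
    by (simp add: sum scale)
  finally show ?thesis .
qed

lemma pure_tensor_delta: "pure_tensor (delta a) (delta b) = delta (a, b)"
  by (auto simp: pure_tensor_def delta_def fun_eq_iff)

lemma tensor_universal:
  fixes s :: "'k::field \<Rightarrow> 'w::ab_group_add \<Rightarrow> 'w"
    and B :: "('a::finite \<Rightarrow> 'k) \<Rightarrow> ('b::finite \<Rightarrow> 'k) \<Rightarrow> 'w"
  assumes l: "\<And>v. Vector_Spaces.linear fscale s (\<lambda>u. B u v)"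
    and r: "\<And>u. Vector_Spaces.linear fscale s (B u)"
  shows "\<exists>!L. Vector_Spaces.linear fscale s L \<and> (\<forall>u v. L (pure_tensor u v) = B u v)"
proof (rule ex1I)
  interpret s: vector_space s
    using r[of 0] by (simp add: Vector_Spaces.linear_iff)
  define L where "L F = (\<Sum>p\<in>UNIV. s (F p) (B (delta (fst p)) (delta (snd p))))" for F
  have "Vector_Spaces.linear fscale s L"
    by (simp add: Vector_Spaces.linear_iff vector_space_fscale s.vector_space_axioms L_def
        fscale_def s.scale_left_distrib sum.distrib s.scale_sum_right)
  moreover have "L (pure_tensor u v) = B u v" for u v
  proof -
    have "L (pure_tensor u v) = (\<Sum>a\<in>UNIV. \<Sum>b\<in>UNIV. s (u a * v b) (B (delta a) (delta b)))"
      by (simp add: L_def pure_tensor_def sum.cartesian_product flip: UNIV_Times_UNIV)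
        (simp add: case_prod_unfold)
    also have "\<dots> = (\<Sum>a\<in>UNIV. s (u a) (\<Sum>b\<in>UNIV. s (v b) (B (delta a) (delta b))))"
      by (simp add: s.scale_sum_right)
    also have "\<dots> = B u v"
      using linear_expansion[OF r, of _ v] linear_expansion[OF l, of u v] by simp
    finally show ?thesis .
  qed
  ultimately show "Vector_Spaces.linear fscale s L \<and> (\<forall>u v. L (pure_tensor u v) = B u v)"
    by blast
  fix L' assume L': "Vector_Spaces.linear fscale s L' \<and> (\<forall>u v. L' (pure_tensor u v) = B u v)"
  have "L' (delta p) = B (delta (fst p)) (delta (snd p))" for p
    using L' pure_tensor_delta[of "fst p" "snd p"] by (metis prod.collapse)
  then have "L' F = L F" for F
    using linear_expansion[of s L' F] L' by (simp add: L_def)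
  then show "L' = L" by (rule ext)
qed

lemma tensor_map_pure:
  assumes "klinear f" "klinear g"
  shows "(f \<boxtimes> g) (pure_tensor u v) = pure_tensor (f u) (g v)"
proof -
  have "f u c = (\<Sum>a\<in>UNIV. u a * f (delta a) c)" for c
    by (subst linear_expansion[OF assms(1)]) (simp add: sum_fun_apply fscale_def)
  moreover have "g v d = (\<Sum>b\<in>UNIV. v b * g (delta b) d)" for d
    by (subst linear_expansion[OF assms(2)]) (simp add: sum_fun_apply fscale_def)
  ultimately show ?thesis
    by (auto simp: tensor_map_def pure_tensor_def fun_eq_iff sum_product ac_simps
        intro!: sum.cong)
qed

lemma tensor_map_linear: "klinear (f \<boxtimes> g)"
  by (simp add: klinear_iff tensor_map_def fscale_def fun_eq_iff distrib_right sum.distrib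
      sum_distrib_left mult.assoc)

text \<open>All structure maps below are pullbacks along maps of the underlying sets.\<close>

definition pullback :: "('b \<Rightarrow> 'a) \<Rightarrow> ('a \<Rightarrow> 'k) \<Rightarrow> ('b \<Rightarrow> 'k)"
  where "pullback p F = (\<lambda>x. F (p x))"

lemma pullback_comp: "pullback p \<circ> pullback q = pullback (q \<circ> p)"
  by (simp add: pullback_def fun_eq_iff)

lemma klinear_pullback: "klinear (pullback p)"
  by (simp add: klinear_iff pullback_def fscale_def fun_eq_iff)

lemma tensor_map_pullback: "pullback p \<boxtimes> pullback q = pullback (map_prod p q)"
proof -
  have "(\<Sum>a\<in>UNIV. \<Sum>b\<in>UNIV. F (a, b) * delta a x * delta b y) = F (x, y)"
    for F :: "'a \<times> 'b \<Rightarrow> 'c" and x y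
    by (simp add: sum_mult_delta)
  then show ?thesis
    by (simp add: tensor_map_def pullback_def fun_eq_iff)
qed

lemma structure_maps_pullback:
  "id = pullback id"
  "flip = pullback (\<lambda>z. (snd z, fst z))"
  "assocl = pullback (\<lambda>z. (fst (fst z), (snd (fst z), snd z)))"
  "assocr = pullback (\<lambda>z. ((fst z, fst (snd z)), snd (snd z)))"
  "unitl = pullback (\<lambda>z. ((), z))"
  "unitr = pullback (\<lambda>z. (z, ()))"
  by (auto simp: flip_def assocl_def assocr_def unitl_def unitr_def pullback_def fun_eq_iff)

lemma swap12_pullback: "swap12 = pullback (\<lambda>z. (fst (snd z), (fst z, snd (snd z))))"
proof -
  have "swap12 = assocr \<circ> (flip \<boxtimes> pullback id) \<circ> assocl"
    by (simp add: swap12_def flip: structure_maps_pullback(1))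
  also have "\<dots> = pullback (\<lambda>z. (fst (snd z), (fst z, snd (snd z))))"
    unfolding structure_maps_pullback(2-) tensor_map_pullback pullback_comp
    by (simp add: fun_eq_iff pullback_def)
  finally show ?thesis .
qed

lemma interchange_pullback:
  "interchange = pullback (\<lambda>z. ((fst (fst z), fst (snd z)), (snd (fst z), snd (snd z))))"
proof -
  have "interchange = assocl \<circ> (pullback id \<boxtimes> swap12) \<circ> assocr"
    by (simp add: interchange_def flip: structure_maps_pullback(1))
  also have "\<dots> = pullback (\<lambda>z. ((fst (fst z), fst (snd z)), (snd (fst z), snd (snd z))))"
    unfolding structure_maps_pullback(2-) swap12_pullback tensor_map_pullback pullback_comp
    by (simp add: fun_eq_iff pullback_def)
  finally show ?thesis .
qed


section \<open>Hopf algebras\<close>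

text \<open>
  A Hopf algebra structure on the vector space of functions on a finite type \<open>'x\<close>; choosing a basis,
  this covers all finite-dimensional Hopf algebras.
\<close>

record ('x, 'k) hopf =
  hmult :: "('x \<times> 'x \<Rightarrow> 'k) \<Rightarrow> ('x \<Rightarrow> 'k)"
  hunit :: "(unit \<Rightarrow> 'k) \<Rightarrow> ('x \<Rightarrow> 'k)"
  hcomult :: "('x \<Rightarrow> 'k) \<Rightarrow> ('x \<times> 'x \<Rightarrow> 'k)"
  hcounit :: "('x \<Rightarrow> 'k) \<Rightarrow> (unit \<Rightarrow> 'k)"
  hantipode :: "('x \<Rightarrow> 'k) \<Rightarrow> ('x \<Rightarrow> 'k)"

locale hopf_algebra =
  fixes H :: "('x::finite, 'k::field) hopf"
  assumes linear: "klinear (hmult H)" "klinear (hunit H)" "klinear (hcomult H)"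
      "klinear (hcounit H)" "klinear (hantipode H)"
    and assoc: "hmult H \<circ> (hmult H \<boxtimes> id) \<circ> assocl = hmult H \<circ> (id \<boxtimes> hmult H)"
    and unit_left: "hmult H \<circ> (hunit H \<boxtimes> id) = unitl"
    and unit_right: "hmult H \<circ> (id \<boxtimes> hunit H) = unitr"
    and coassoc: "assocr \<circ> (hcomult H \<boxtimes> id) \<circ> hcomult H = (id \<boxtimes> hcomult H) \<circ> hcomult H"
    and counit_left: "unitl \<circ> (hcounit H \<boxtimes> id) \<circ> hcomult H = id"
    and counit_right: "unitr \<circ> (id \<boxtimes> hcounit H) \<circ> hcomult H = id"
    and comult_mult: "hcomult H \<circ> hmult H =
      (hmult H \<boxtimes> hmult H) \<circ> interchange \<circ> (hcomult H \<boxtimes> hcomult H)"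
    and comult_unit: "hcomult H \<circ> hunit H \<circ> unitl = hunit H \<boxtimes> hunit H"
    and counit_mult: "hcounit H \<circ> hmult H = unitl \<circ> (hcounit H \<boxtimes> hcounit H)"
    and counit_unit: "hcounit H \<circ> hunit H = id"
    and antipode_left: "hmult H \<circ> (hantipode H \<boxtimes> id) \<circ> hcomult H = hunit H \<circ> hcounit H"
    and antipode_right: "hmult H \<circ> (id \<boxtimes> hantipode H) \<circ> hcomult H = hunit H \<circ> hcounit H"

text \<open>
  The Hopf algebra of functions on a finite group. The class \<open>group_add\<close> is that of arbitrary, not
  necessarily commutative, groups: \<open>u + v\<close>, \<open>- u\<close> and \<open>0\<close> are the product, the inverse and the
  identity. Multiplication, \<open>f \<otimes> g \<mapsto> f * g\<close>, is restriction to the diagonal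
  (\<open>function_hopf_mult\<close>).
\<close>

definition function_hopf :: "('g::{finite,group_add}, 'k::field) hopf"
  where "function_hopf =
    \<lparr>hmult = (\<lambda>F x. F (x, x)),
     hunit = (\<lambda>c x. c ()),
     hcomult = (\<lambda>f (u, v). f (u + v)),
     hcounit = (\<lambda>f _. f 0),
     hantipode = (\<lambda>f x. f (- x))\<rparr>"

lemma function_hopf_mult: "hmult function_hopf (pure_tensor f g) = f * g"
  by (simp add: function_hopf_def pure_tensor_def fun_eq_iff)

lemma function_hopf_pullback:
  "hmult function_hopf = pullback (\<lambda>x. (x, x))"
  "hunit function_hopf = pullback (\<lambda>x. ())"
  "hcomult function_hopf = pullback (\<lambda>z. fst z + snd z)"
  "hcounit function_hopf = pullback (\<lambda>z. 0)"
  "hantipode function_hopf = pullback uminus"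
  by (auto simp: function_hopf_def pullback_def fun_eq_iff)

lemma hopf_algebra_function_hopf:
  "hopf_algebra (function_hopf :: ('g::{finite,group_add}, 'k::field) hopf)"
  unfolding hopf_algebra_def function_hopf_pullback
  unfolding structure_maps_pullback(2-) interchange_pullback
  unfolding structure_maps_pullback(1)[where ?'a = 'g and ?'b = 'k]
    structure_maps_pullback(1)[where ?'a = unit and ?'b = 'k]
    tensor_map_pullback pullback_comp
  by (simp add: klinear_pullback) (simp add: fun_eq_iff pullback_def add.assoc)


section \<open>Adjoint cohomology\<close>

text \<open>The adjoint map \<open>x \<otimes> y \<mapsto> S(y\<^sub>1) x y\<^sub>2\<close>.\<close>

definition hopf_ad :: "('x::finite, 'k::field) hopf \<Rightarrow> ('x \<times> 'x \<Rightarrow> 'k) \<Rightarrow> ('x \<Rightarrow> 'k)"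
  where "hopf_ad H =
    hmult H \<circ> (id \<boxtimes> hmult H) \<circ> (hantipode H \<boxtimes> id) \<circ> swap12 \<circ> (id \<boxtimes> hcomult H)"

text \<open>
  Cochain spaces and cohomology are recorded as their underlying additive groups. Since \<open>C\<^sup>0 = 0\<close>,
  there are no coboundaries to divide out in degree 1.
\<close>

definition additive_group :: "'a::ab_group_add set \<Rightarrow> 'a monoid"
  where "additive_group A = \<lparr>carrier = A, monoid.mult = (+), one = 0\<rparr>"

definition cochains1 :: "('x::finite, 'k::field) hopf \<Rightarrow> (('x \<Rightarrow> 'k) \<Rightarrow> ('x \<Rightarrow> 'k)) monoid"
  where "cochains1 H = additive_group
    {f. klinear f \<and>
        f \<circ> hmult H = (hmult H \<circ> (f \<boxtimes> id)) + (hmult H \<circ> (id \<boxtimes> f)) \<and>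
        hcomult H \<circ> f = ((f \<boxtimes> id) \<circ> hcomult H) + ((id \<boxtimes> f) \<circ> hcomult H)}"

definition cochains2 ::
    "('x::finite, 'k::field) hopf \<Rightarrow> (('x \<times> 'x \<Rightarrow> 'k) \<Rightarrow> ('x \<Rightarrow> 'k)) monoid"
  where "cochains2 H = additive_group {\<phi>. klinear \<phi>}"

definition cochains3 :: "('x::finite, 'k::field) hopf \<Rightarrow>
    ((('x \<times> 'x \<times> 'x \<Rightarrow> 'k) \<Rightarrow> ('x \<Rightarrow> 'k)) \<times> (('x \<times> 'x \<Rightarrow> 'k) \<Rightarrow> ('x \<times> 'x \<Rightarrow> 'k))) monoid"
  where "cochains3 H = additive_group ({\<psi>. klinear \<psi>} \<times> {\<psi>. klinear \<psi>})"

definition diff1 :: "('x::finite, 'k::field) hopf \<Rightarrow>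
    (('x \<Rightarrow> 'k) \<Rightarrow> ('x \<Rightarrow> 'k)) \<Rightarrow> (('x \<times> 'x \<Rightarrow> 'k) \<Rightarrow> ('x \<Rightarrow> 'k))"
  where "diff1 H f =
    (hopf_ad H \<circ> (id \<boxtimes> f)) - (f \<circ> hopf_ad H) + (hopf_ad H \<circ> (f \<boxtimes> id))"

definition diff21 :: "('x::finite, 'k::field) hopf \<Rightarrow>
    (('x \<times> 'x \<Rightarrow> 'k) \<Rightarrow> ('x \<Rightarrow> 'k)) \<Rightarrow> (('x \<times> 'x \<times> 'x \<Rightarrow> 'k) \<Rightarrow> ('x \<Rightarrow> 'k))"
  where "diff21 H \<phi> =
    (hopf_ad H \<circ> (\<phi> \<boxtimes> id) \<circ> assocl) + (\<phi> \<circ> (hopf_ad H \<boxtimes> id) \<circ> assocl)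
    - (\<phi> \<circ> (id \<boxtimes> hmult H))"

definition diff22 :: "('x::finite, 'k::field) hopf \<Rightarrow>
    (('x \<times> 'x \<Rightarrow> 'k) \<Rightarrow> ('x \<Rightarrow> 'k)) \<Rightarrow> (('x \<times> 'x \<Rightarrow> 'k) \<Rightarrow> ('x \<times> 'x \<Rightarrow> 'k))"
  where "diff22 H \<phi> =
    ((\<phi> \<boxtimes> hmult H) \<circ> interchange \<circ> (hcomult H \<boxtimes> hcomult H))
    - ((id \<boxtimes> hmult H) \<circ> swap12 \<circ> (id \<boxtimes> hcomult H) \<circ> (id \<boxtimes> \<phi>) \<circ> swap12 \<circ> (id \<boxtimes> hcomult H))"

definition diff2 :: "('x::finite, 'k::field) hopf \<Rightarrow>
    (('x \<times> 'x \<Rightarrow> 'k) \<Rightarrow> ('x \<Rightarrow> 'k)) \<Rightarrow>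
    ((('x \<times> 'x \<times> 'x \<Rightarrow> 'k) \<Rightarrow> ('x \<Rightarrow> 'k)) \<times> (('x \<times> 'x \<Rightarrow> 'k) \<Rightarrow> ('x \<times> 'x \<Rightarrow> 'k)))"
  where "diff2 H \<phi> = (diff21 H \<phi>, diff22 H \<phi>)"

definition adjoint_H1 :: "('x::finite, 'k::field) hopf \<Rightarrow> (('x \<Rightarrow> 'k) \<Rightarrow> ('x \<Rightarrow> 'k)) monoid"
  where "adjoint_H1 H =
    additive_group (kernel (cochains1 H) (cochains2 H) (diff1 H))"

definition adjoint_H2 ::
    "('x::finite, 'k::field) hopf \<Rightarrow> (('x \<times> 'x \<Rightarrow> 'k) \<Rightarrow> ('x \<Rightarrow> 'k)) set monoid"
  where "adjoint_H2 H =
    additive_group (kernel (cochains2 H) (cochains3 H) (diff2 H))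
      Mod (diff1 H ` carrier (cochains1 H))"

end

theory Submission
  imports Defs
begin

text \<open>
  Both kernels vanish because \<open>k\<^sup>G\<close> has a basis of idempotents \<open>\<delta>\<^sub>a\<close>. A derivation \<open>f\<close> satisfies
  \<open>f(\<delta>\<^sub>a) = 2 \<delta>\<^sub>a f(\<delta>\<^sub>a)\<close>, so \<open>f = 0\<close> in every characteristic. Moreover
  \<open>ad(x \<otimes> y) = y(1) x\<close>, and evaluating \<open>d\<^sup>2\<^sup>,\<^sup>1(\<phi>) = 0\<close> at \<open>x \<otimes> \<delta>\<^sub>b \<otimes> \<delta>\<^sub>b\<close> gives
  \<open>2 \<delta>\<^sub>b(1) \<phi>(x \<otimes> \<delta>\<^sub>b) = \<phi>(x \<otimes> \<delta>\<^sub>b)\<close>, so \<open>\<phi> = 0\<close>.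
\<close>

lemma klinear_eq_zeroI:
  fixes f :: "('a::finite \<Rightarrow> 'k::field) \<Rightarrow> 'b \<Rightarrow> 'k"
  assumes "klinear f" "\<And>a. f (delta a) = 0"
  shows "f = 0"
proof
  show "f u = 0 u" for u
    by (subst linear_expansion[OF assms(1)]) (simp add: assms(2) fscale_def fun_eq_iff sum_fun_apply)
qed

text \<open>For e = 0 the right side vanishes; for e = 1 one copy of u cancels. No division by 2
  occurs, so characteristic 2 is covered.\<close>

lemma eq_twice_imp_zero:
  fixes u e :: "'k::field"
  assumes "u = e * u + e * u" "e = 0 \<or> e = 1"
  shows "u = 0"
  using assms by (metis add_cancel_left_left mult.left_neutral mult.right_neutral mult_zero_left
      mult_zero_right)

lemma klinear_zero: "klinear 0"
  by (simp add: klinear_iff fscale_def fun_eq_iff)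

lemma klinear_id: "klinear id"
  by (simp add: klinear_iff)

lemma zero_tensor_map: "0 \<boxtimes> g = 0" and tensor_map_zero: "f \<boxtimes> 0 = 0"
  by (simp_all add: tensor_map_def fun_eq_iff)

lemma trivial_group_singleton_zero: "trivial_group (additive_group {0})"
proof -
  have "group (additive_group {0})"
    by (rule groupI) (simp_all add: additive_group_def)
  then show ?thesis
    by (simp add: trivial_group_def additive_group_def)
qed

text \<open>The subgroup is that of the identity, hence normal, and its only coset is {0}. This is
  the form \<open>adjoint_H2\<close> takes once cocycles and coboundaries are both {0}.\<close>

lemma trivial_group_singleton_zero_Mod:
  "trivial_group (additive_group {0 :: 'a::ab_group_add} Mod {0})"
proof -
  interpret group "additive_group {0 :: 'a}"
    by (rule trivial_group_singleton_zero[unfolded trivial_group_def, THEN conjunct1])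
  have one: "\<one>\<^bsub>additive_group {0 :: 'a}\<^esub> = 0"
    by (simp add: additive_group_def)
  have normal: "{0 :: 'a} \<lhd> additive_group {0}"
    using one_is_normal by (simp only: one)
  have "carrier (additive_group {0 :: 'a} Mod {0}) = {{0}}"
    by (auto simp: FactGroup_def RCOSETS_def r_coset_def additive_group_def)
  then show ?thesis
    using normal.factorgroup_is_group[OF normal] by (simp add: trivial_group_def FactGroup_def)
qed

text \<open>Composing the underlying set maps sends x to (x, - x + x) = (x, 0): the antipode meets
  the comultiplication and the second argument is evaluated at the identity of the group.\<close>

lemma hopf_ad_function_hopf:
  "hopf_ad (function_hopf :: ('g::{finite,group_add}, 'k::field) hopf) = pullback (\<lambda>x. (x, 0))"
  unfolding hopf_ad_def function_hopf_pullback swap12_pullback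
  unfolding structure_maps_pullback(1)[where ?'a = 'g and ?'b = 'k]
    structure_maps_pullback(1)[where ?'a = "'g \<times> 'g" and ?'b = 'k]
    tensor_map_pullback pullback_comp
  by (simp add: fun_eq_iff pullback_def)

lemma carrier_cochains1_function_hopf:
  "carrier (cochains1 (function_hopf :: ('g::{finite,group_add}, 'k::field) hopf)) = {0}"
    (is "carrier (cochains1 ?H) = _")
proof -
  have "f = 0" if lin: "klinear f"
    and der: "f \<circ> hmult ?H = (hmult ?H \<circ> (f \<boxtimes> id)) + (hmult ?H \<circ> (id \<boxtimes> f))"
    for f :: "('g \<Rightarrow> 'k) \<Rightarrow> 'g \<Rightarrow> 'k"
  proof (rule klinear_eq_zeroI[OF lin])
    fix a :: 'g
    have "f (delta a * delta a) = delta a * f (delta a) + delta a * f (delta a)"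
      using fun_cong[OF der, of "pure_tensor (delta a) (delta a)"]
      by (simp add: function_hopf_mult tensor_map_pure lin klinear_id mult.commute)
    moreover have "delta a * delta a = (delta a :: 'g \<Rightarrow> 'k)"
      by (simp add: delta_def fun_eq_iff)
    ultimately have eq: "f (delta a) = delta a * f (delta a) + delta a * f (delta a)"
      by metis
    \<comment> \<open>At each point x the factor \<open>delta a x\<close> is 0 or 1 and serves as e
      in \<open>eq_twice_imp_zero\<close>.\<close>
    note * = fun_cong[OF eq, unfolded plus_fun_apply times_fun_apply]
    have "f (delta a) x = 0" for x
      by (rule eq_twice_imp_zero[OF *]) (simp add: delta_def)
    then show "f (delta a) = 0"
      by (simp add: fun_eq_iff)
  qed
  moreover have "0 \<in> carrier (cochains1 ?H)"
    by (simp add: cochains1_def additive_group_def klinear_zero zero_tensor_map tensor_map_zero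
        function_hopf_pullback pullback_def fun_eq_iff)
  ultimately show ?thesis
    by (auto simp: cochains1_def additive_group_def)
qed

text \<open>As the only 1-cochain is 0, this value determines both the kernel and the image of
  D_1.\<close>

lemma diff1_zero:
  "diff1 (function_hopf :: ('g::{finite,group_add}, 'k::field) hopf) 0 = 0"
  by (simp add: diff1_def hopf_ad_function_hopf zero_tensor_map tensor_map_zero pullback_def
      fun_eq_iff)

lemma diff2_zero:
  "diff2 (function_hopf :: ('g::{finite,group_add}, 'k::field) hopf) 0 = 0"
  by (simp add: diff2_def diff21_def diff22_def hopf_ad_function_hopf zero_tensor_map
      tensor_map_zero swap12_pullback function_hopf_pullback tensor_map_def pullback_def
      zero_prod_def fun_eq_iff)

lemma diff21_eq_zero_imp:
  fixes \<phi> :: "('g::{finite,group_add} \<times> 'g \<Rightarrow> 'k::field) \<Rightarrow> 'g \<Rightarrow> 'k"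
  assumes lin: "klinear \<phi>" and closed: "diff21 function_hopf \<phi> = 0"
  shows "\<phi> = 0"
proof (rule klinear_eq_zeroI[OF lin])
  fix p :: "'g \<times> 'g"
  obtain a b where p: "p = (a, b)" by fastforce
  define d :: "'g \<Rightarrow> 'k" where "d = delta b"
  let ?t = "pure_tensor (delta a) d"
  have assocl: "assocl (pure_tensor (delta a) (pure_tensor d d)) = pure_tensor ?t d"
    by (simp add: assocl_def pure_tensor_def fun_eq_iff)
  have ad: "pullback (\<lambda>x. (x, 0)) (pure_tensor u d) = fscale (d 0) u" for u :: "'g \<Rightarrow> 'k"
    by (simp add: pullback_def pure_tensor_def fscale_def fun_eq_iff)
  have scale: "pure_tensor (fscale c u) v = fscale c (pure_tensor u v)"
    for c and u v :: "'g \<Rightarrow> 'k"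
    by (simp add: pure_tensor_def fscale_def fun_eq_iff mult.assoc)
  have lin_mult: "klinear (hmult (function_hopf :: ('g, 'k) hopf))"
    by (simp add: function_hopf_pullback klinear_pullback)
  have \<phi>_scale: "\<phi> (fscale c F) = fscale c (\<phi> F)" for c F
    using lin by (simp add: klinear_iff)
  have idem: "d * d = d"
    by (simp add: d_def delta_def fun_eq_iff)
  \<comment> \<open>The first term acts by ad on \<phi>(?t) \<otimes> d; the second pulls the scalar
    \<open>d 0\<close> out of \<phi> by linearity; the third reduces to \<phi>(?t) because d is
    idempotent.\<close>
  have "fscale (d 0) (\<phi> ?t) + fscale (d 0) (\<phi> ?t) - \<phi> ?t = 0"
    using fun_cong[OF closed, of "pure_tensor (delta a) (pure_tensor d d)"]
    by (simp add: diff21_def hopf_ad_function_hopf assocl tensor_map_pure lin lin_mult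
        klinear_id klinear_pullback function_hopf_mult ad scale idem \<phi>_scale)
  then have eq: "\<phi> ?t = fscale (d 0) (\<phi> ?t) + fscale (d 0) (\<phi> ?t)"
    by (metis eq_iff_diff_eq_0)
  \<comment> \<open>Here e is the constant \<open>d 0\<close>, which is 1 if b is the identity and 0
    otherwise.\<close>
  note * = fun_cong[OF eq, unfolded plus_fun_apply fscale_def]
  have "\<phi> ?t x = 0" for x
    by (rule eq_twice_imp_zero[OF *]) (simp add: d_def delta_def)
  then have "\<phi> ?t = 0"
    by (simp add: fun_eq_iff)
  then show "\<phi> (delta p) = 0"
    by (simp add: p d_def pure_tensor_delta)
qed

theorem theorem5p10:
  shows "trivial_group (adjoint_H1 (function_hopf :: ('g::{finite,group_add}, 'k::field) hopf)) \<and>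
    trivial_group (adjoint_H2 (function_hopf :: ('g::{finite,group_add}, 'k::field) hopf))"
proof -
  let ?H = "function_hopf :: ('g, 'k) hopf"
  have "kernel (cochains1 ?H) (cochains2 ?H) (diff1 ?H) = {0}"
    by (auto simp: kernel_def carrier_cochains1_function_hopf diff1_zero cochains2_def
        additive_group_def)
  \<comment> \<open>The first component of D_2 already forces a cocycle to vanish;
    \<open>diff2_zero\<close> gives the converse inclusion.\<close>
  moreover have "kernel (cochains2 ?H) (cochains3 ?H) (diff2 ?H) = {0}"
    using diff21_eq_zero_imp diff2_zero[where ?'g = 'g and ?'k = 'k]
    by (auto simp: kernel_def cochains2_def cochains3_def additive_group_def klinear_zero
        diff2_def zero_prod_def)
  ultimately show ?thesis
    by (simp add: adjoint_H1_def adjoint_H2_def trivial_group_singleton_zero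
        trivial_group_singleton_zero_Mod carrier_cochains1_function_hopf diff1_zero)
qed

end
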